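(* Let $n,c$ be positive integers and $a\in\{1,\dots,c\}$. Then $$\left|\Pi_n^{eq}\wr C_c(1^a2^a3^a)\right|=B(n)(c-1)^n+\sum_{i=1}^n\sum_{r=1}^i\binom{n}{i}\binom{i}{r}B(n-i)(c-1)^{n-r}$$ $$+\sum_{i=2}^n\sum_{j=1}^{i-1}\sum_{r_1=1}^{i-j}\sum_{r_2=1}^j\binom{n}{i}\binom{i-1}{j}\binom{i-j}{r_1}\binom{j}{r_2}B(n-i)(c-1)^{n-r_1-r_2}.$$
   Context: $\Pi_n\wr C_c$ is the set of colored set partitions of $[n]$: a set partition of $[n]$ together with a color in $\{1,\dots,c\}$ for each element. A colored partition eq-contains $1^a2^a3^a$ iff there are elements $x<y<z$ lying in three distinct blocks, all colored $a$; $\Pi_n^{eq}\wr C_c(1^a2^a3^a)$ is the set of those that do not. $B(m)$ is the $m$-th Bell number. *)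

theory Defs
  imports "HOL-Library.Disjoint_Sets" "HOL-Library.FuncSet"
begin

definition Bell :: "nat \<Rightarrow> nat" where
  "Bell m = card {P. partition_on {1..m} P}"

text \<open>A colored partition is a pair of a set partition and a coloring; colorings are extensional
  functions, so that they are determined by their values on \<open>{1..n}\<close>.\<close>

definition colored_partitions :: "nat \<Rightarrow> nat \<Rightarrow> (nat set set \<times> (nat \<Rightarrow> nat)) set" where
  "colored_partitions n c = {P. partition_on {1..n} P} \<times> ({1..n} \<rightarrow>\<^sub>E {1..c})"

definition eq_contains_123 :: "nat \<Rightarrow> nat set set \<times> (nat \<Rightarrow> nat) \<Rightarrow> bool" where
  "eq_contains_123 a \<sigma> \<longleftrightarrow> (case \<sigma> of (P, col) \<Rightarrow>
     \<exists>x y z. x < y \<and> y < z \<and>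
       (\<exists>X\<in>P. \<exists>Y\<in>P. \<exists>Z\<in>P. X \<noteq> Y \<and> X \<noteq> Z \<and> Y \<noteq> Z \<and> x \<in> X \<and> y \<in> Y \<and> z \<in> Z) \<and>
       col x = a \<and> col y = a \<and> col z = a)"

definition eq_avoiders_123 :: "nat \<Rightarrow> nat \<Rightarrow> nat \<Rightarrow> (nat set set \<times> (nat \<Rightarrow> nat)) set" where
  "eq_avoiders_123 n c a = {\<sigma> \<in> colored_partitions n c. \<not> eq_contains_123 a \<sigma>}"

end

theory Submission imports Defs begin

text \<open>A colored partition avoids the pattern iff at most two of its blocks contain an element of
  color \<open>a\<close>. For a fixed family \<open>K\<close> of such blocks, with union \<open>U\<close>, the partition and the coloring
  can be chosen independently: there are \<open>Bell (n - card U)\<close> partitions containing \<open>K\<close>, and a block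
  of size \<open>m\<close> in \<open>K\<close> can be colored in \<open>c ^ m - (c - 1) ^ m = (\<Sum>r=1..m. (m choose r) * (c - 1) ^ (m - r))\<close>
  ways. It remains to sum over all \<open>K\<close> with at most two blocks; for two blocks, \<open>j\<close> is the size of
  the block that does not contain the minimum of the union.\<close>

section \<open>Blocks and colorings that meet a given color\<close>

definition hit_blocks :: "'b \<Rightarrow> 'a set set \<Rightarrow> ('a \<Rightarrow> 'b) \<Rightarrow> 'a set set" where
  "hit_blocks a P f = {X \<in> P. \<exists>x\<in>X. f x = a}"

text \<open>The condition mentions only the family \<open>K\<close> and no partition containing it.
  This is what lets the coloring and the rest of the partition vary independently.\<close>

definition hitting_colorings :: "'a set \<Rightarrow> 'b set \<Rightarrow> 'b \<Rightarrow> 'a set set \<Rightarrow> ('a \<Rightarrow> 'b) set" where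
  "hitting_colorings A S a K =
     {f \<in> A \<rightarrow>\<^sub>E S. (\<forall>X\<in>K. \<exists>x\<in>X. f x = a) \<and> (\<forall>x\<in>A - \<Union>K. f x \<noteq> a)}"

text \<open>For \<open>c \<ge> 1\<close> this counts the maps from an m-set to c colors that use one
  fixed color, sorted by the number r of elements receiving it. It is kept as a sum because the
  target formula has the same sums over r.\<close>

definition hit_weight :: "nat \<Rightarrow> nat \<Rightarrow> nat" where
  "hit_weight c m = (\<Sum>r=1..m. (m choose r) * (c - 1) ^ (m - r))"

section \<open>Counting set partitions, with or without prescribed blocks\<close>

lemma partition_on_block_unique:
  assumes "partition_on A P" "X \<in> P" "Y \<in> P" "x \<in> X" "x \<in> Y"
  shows "X = Y"
  using assms unfolding partition_on_def disjoint_def by blast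

text \<open>Partitions are transported blockwise along a bijection \<open>h\<close> onto
  \<open>{1..card A}\<close>, with inverse induced by \<open>g\<close>.\<close>

lemma card_partitions_eq_Bell:
  assumes "finite A"
  shows "card {P. partition_on A P} = Bell (card A)"
proof -
  obtain h where h: "bij_betw h A {1..card A}"
    using assms by (metis bij_betw_iff_card card_atLeastAtMost diff_Suc_1 finite_atLeastAtMost)
  then have inj: "inj_on h A" and im: "h ` A = {1..card A}"
    by (auto simp: bij_betw_def)
  define g where "g = inv_into A h"
  have g: "inj_on g {1..card A}" "g ` {1..card A} = A"
    using h unfolding g_def by (metis bij_betw_def bij_betw_inv_into)+
  have gh: "g ` h ` X = X" if "X \<subseteq> A" for X
    using inv_into_image_cancel[OF inj that] by (simp add: g_def)
  have hg: "h ` g ` X = X" if "X \<subseteq> {1..card A}" for X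
    using image_inv_into_cancel[OF im that] by (simp add: g_def)
  \<comment> \<open>\<open>partition_on_inj_image\<close> discards the empty set from the image
    family; since no block is empty, nothing is lost.\<close>
  have img: "partition_on (f ` B) ((`) f ` P)" if "inj_on f B" "partition_on B P"
    for f :: "'c \<Rightarrow> 'd" and B P
    using partition_on_inj_image[OF that(2,1)] partition_onD3[OF that(2)]
    by (metis Diff_empty Diff_insert0 image_iff image_is_empty)
  have "bij_betw (\<lambda>P. (`) h ` P) {P. partition_on A P} {P. partition_on {1..card A} P}"
  proof (rule bij_betwI[where g = "\<lambda>P. (`) g ` P"])
    show "(\<lambda>P. (`) h ` P) \<in> {P. partition_on A P} \<rightarrow> {P. partition_on {1..card A} P}"
      using img[OF inj] im by auto
    show "(\<lambda>P. (`) g ` P) \<in> {P. partition_on {1..card A} P} \<rightarrow> {P. partition_on A P}"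
      using img[OF g(1)] g(2) by auto
  next
    fix P assume "P \<in> {P. partition_on A P}"
    then have "\<And>X. X \<in> P \<Longrightarrow> X \<subseteq> A" by (auto simp: partition_on_def)
    then show "(`) g ` (`) h ` P = P" using gh by (force simp: image_image)
  next
    fix P assume "P \<in> {P. partition_on {1..card A} P}"
    then have "\<And>X. X \<in> P \<Longrightarrow> X \<subseteq> {1..card A}" by (auto simp: partition_on_def)
    then show "(`) h ` (`) g ` P = P" using hg by (force simp: image_image)
  qed
  then show ?thesis by (simp add: Bell_def bij_betw_same_card)
qed

text \<open>Removing \<open>K\<close> leaves an arbitrary partition of \<open>A - \<Union>K\<close>,
  and adjoining \<open>K\<close> again is the inverse operation.\<close>

lemma card_partitions_containing:
  assumes "finite A" "partition_on (\<Union>K) K" "\<Union>K \<subseteq> A"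
  shows "card {P. partition_on A P \<and> K \<subseteq> P} = Bell (card A - card (\<Union>K))"
proof -
  have "bij_betw (\<lambda>P. P - K) {P. partition_on A P \<and> K \<subseteq> P} {Q. partition_on (A - \<Union>K) Q}"
  proof (rule bij_betwI[where g = "\<lambda>Q. Q \<union> K"])
    show "(\<lambda>P. P - K) \<in> {P. partition_on A P \<and> K \<subseteq> P} \<rightarrow> {Q. partition_on (A - \<Union>K) Q}"
    proof clarsimp
      fix P assume P: "partition_on A P" "K \<subseteq> P"
      have "\<Union>(P - K) = A - \<Union>K"
        using P partition_onD1[OF P(1)] partition_on_block_unique[OF P(1)] by blast
      then show "partition_on (A - \<Union>K) (P - K)"
        using P pairwise_subset[of disjnt P "P - K"] by (auto simp: partition_on_def)
    qed
    show "(\<lambda>Q. Q \<union> K) \<in> {Q. partition_on (A - \<Union>K) Q} \<rightarrow> {P. partition_on A P \<and> K \<subseteq> P}"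
    proof clarsimp
      fix Q assume Q: "partition_on (A - \<Union>K) Q"
      have "partition_on ((A - \<Union>K) \<union> \<Union>K) (Q \<union> K)"
        using Q assms(2) disjoint_union[of Q K] by (auto simp: partition_on_def)
      then show "partition_on A (Q \<union> K)"
        using assms(3) by (simp add: Un_absorb2)
    qed
  next
    fix P assume "P \<in> {P. partition_on A P \<and> K \<subseteq> P}"
    then show "P - K \<union> K = P" by auto
  next
    fix Q assume "Q \<in> {Q. partition_on (A - \<Union>K) Q}"
    then have Q: "\<Union>Q = A - \<Union>K" "{} \<notin> Q" by (auto simp: partition_on_def)
    \<comment> \<open>A member of \<open>K\<close> would be contained in \<open>\<Union>K\<close>,
      while a block of \<open>Q\<close> is nonempty and disjoint from it.\<close>
    have "X \<notin> K" if "X \<in> Q" for X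
    proof -
      have "X \<noteq> {}" "X \<subseteq> A - \<Union>K" using that Q by auto
      then show ?thesis by blast
    qed
    then show "Q \<union> K - K = Q" by auto
  qed
  then have "card {P. partition_on A P \<and> K \<subseteq> P} = Bell (card (A - \<Union>K))"
    using assms(1) by (simp add: bij_betw_same_card card_partitions_eq_Bell)
  then show ?thesis
    using assms(1,3) by (metis card_Diff_subset finite_subset)
qed

section \<open>Counting colorings with prescribed hit blocks\<close>

lemma hit_weight_altdef:
  assumes "c \<ge> 1"
  shows "hit_weight c m = c ^ m - (c - 1) ^ m"
proof -
  \<comment> \<open>Binomial expansion of \<open>1 + (c - 1)\<close>, which equals \<open>c\<close>
    in the naturals because \<open>c \<ge> 1\<close>. Its term for r = 0 is the one missing from
    \<open>hit_weight\<close>.\<close>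
  have "c ^ m = (\<Sum>r\<le>m. (m choose r) * (c - 1) ^ (m - r))"
    using binomial[of 1 "c - 1" m] assms by simp
  also have "\<dots> = (c - 1) ^ m + hit_weight c m"
    unfolding hit_weight_def atMost_atLeast0
    by (subst sum.atLeast_Suc_atMost) auto
  finally show ?thesis by simp
qed

text \<open>Complementary counting: from all maps into \<open>S\<close> remove those into
  \<open>S - {a}\<close>.\<close>

lemma card_hitting_functions:
  assumes "finite X" "finite S" "a \<in> S"
  shows "card {f \<in> X \<rightarrow>\<^sub>E S. \<exists>x\<in>X. f x = a} = hit_weight (card S) (card X)"
proof -
  have eq: "{f \<in> X \<rightarrow>\<^sub>E S. \<exists>x\<in>X. f x = a} = (X \<rightarrow>\<^sub>E S) - (X \<rightarrow>\<^sub>E (S - {a}))"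
    by (fastforce simp: PiE_iff)
  have "(X \<rightarrow>\<^sub>E (S - {a})) \<subseteq> (X \<rightarrow>\<^sub>E S)" by (rule PiE_mono) auto
  moreover have "card S \<ge> 1" using assms by (metis One_nat_def Suc_leI card_gt_0_iff empty_iff)
  ultimately show ?thesis
    unfolding eq using assms
    by (simp add: card_Diff_subset finite_PiE card_PiE hit_weight_altdef)
qed

text \<open>Induction on \<open>K\<close>: a coloring splits into independent restrictions to the
  new block \<open>X\<close> and to \<open>A - X\<close>, so \<open>A\<close> must be allowed to
  shrink. Once no block is left, all remaining elements avoid \<open>a\<close>.\<close>

lemma card_hitting_colorings:
  assumes "finite S" "a \<in> S" "finite K" "finite A" "disjoint K" "\<Union>K \<subseteq> A"
  shows "card (hitting_colorings A S a K) =
    (\<Prod>X\<in>K. hit_weight (card S) (card X)) * (card S - 1) ^ (card A - card (\<Union>K))"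
  using assms(3-)
proof (induction K arbitrary: A rule: finite_induct)
  case empty
  have "hitting_colorings A S a {} = A \<rightarrow>\<^sub>E (S - {a})"
    by (auto simp: hitting_colorings_def PiE_iff extensional_def)
  then show ?case using assms(1,2) empty by (simp add: card_PiE)
next
  case (insert X K)
  have XA: "X \<subseteq> A" and KA: "\<Union>K \<subseteq> A - X"
    using insert.prems insert.hyps by (auto simp: disjoint_def)
  have disj: "X \<inter> \<Union>K = {}" and dK: "disjoint K"
    using insert.prems insert.hyps by (auto simp: disjoint_def)
  have fX: "finite X" "finite (\<Union>K)" using XA KA insert.prems by (auto intro: finite_subset)
  let ?H = "{f \<in> X \<rightarrow>\<^sub>E S. \<exists>x\<in>X. f x = a}"
  let ?T = "hitting_colorings (A - X) S a K"
  \<comment> \<open>Outside \<open>A\<close> the glued function takes the value of \<open>g\<close>,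
    which is \<open>undefined\<close> there, so it is extensional on \<open>A\<close>.\<close>
  let ?merge = "\<lambda>(f, g) x. if x \<in> X then f x else g x"
  have "bij_betw (\<lambda>f. (restrict f X, restrict f (A - X))) (hitting_colorings A S a (insert X K)) (?H \<times> ?T)"
  proof (rule bij_betwI[where g = ?merge])
    show "(\<lambda>f. (restrict f X, restrict f (A - X))) \<in> hitting_colorings A S a (insert X K) \<rightarrow> ?H \<times> ?T"
    proof
      fix f assume f: "f \<in> hitting_colorings A S a (insert X K)"
      then have S: "\<And>x. x \<in> A \<Longrightarrow> f x \<in> S" and hX: "\<exists>x\<in>X. f x = a"
        and hK: "\<And>Y. Y \<in> K \<Longrightarrow> \<exists>y\<in>Y. f y = a"
        and nh: "\<And>x. x \<in> A \<Longrightarrow> x \<notin> X \<Longrightarrow> x \<notin> \<Union>K \<Longrightarrow> f x \<noteq> a"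
        by (auto simp: hitting_colorings_def PiE_iff)
      have "restrict f X \<in> ?H" using S hX XA by auto
      moreover have "\<exists>y\<in>Y. restrict f (A - X) y = a" if Y: "Y \<in> K" for Y
      proof -
        obtain y where y: "y \<in> Y" "f y = a" using hK Y by blast
        then have "y \<in> A - X" using KA Y by blast
        then show ?thesis using y by (intro bexI[of _ y]) auto
      qed
      then have "restrict f (A - X) \<in> ?T"
        using S nh by (auto simp: hitting_colorings_def)
      ultimately show "(restrict f X, restrict f (A - X)) \<in> ?H \<times> ?T" by blast
    qed
    show "?merge \<in> ?H \<times> ?T \<rightarrow> hitting_colorings A S a (insert X K)"
    proof
      fix p assume p: "p \<in> ?H \<times> ?T"
      then obtain f g x where fg: "p = (f, g)" and f: "f \<in> X \<rightarrow>\<^sub>E S" and x: "x \<in> X" "f x = a"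
        and g: "g \<in> ?T" by blast
      have gS: "\<And>y. y \<in> A - X \<Longrightarrow> g y \<in> S" and gK: "\<And>Y. Y \<in> K \<Longrightarrow> \<exists>y\<in>Y. g y = a"
        and gn: "\<And>y. y \<in> A - X - \<Union>K \<Longrightarrow> g y \<noteq> a" and ge: "\<And>y. y \<notin> A - X \<Longrightarrow> g y = undefined"
        using g by (auto simp: hitting_colorings_def PiE_iff extensional_def)
      have "\<exists>y\<in>Y. ?merge (f, g) y = a" if Y: "Y \<in> K" for Y
      proof -
        obtain y where y: "y \<in> Y" "g y = a" using gK Y by blast
        then have "y \<notin> X" using KA Y by blast
        then show ?thesis using y by (intro bexI[of _ y]) auto
      qed
      moreover have "\<exists>y\<in>X. ?merge (f, g) y = a" using x by auto
      moreover have "?merge (f, g) \<in> A \<rightarrow>\<^sub>E S"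
        using f gS ge XA by (auto simp: PiE_iff extensional_def)
      ultimately show "?merge p \<in> hitting_colorings A S a (insert X K)"
        using gn by (auto simp: fg hitting_colorings_def)
    qed
  next
    fix f assume "f \<in> hitting_colorings A S a (insert X K)"
    then have "f \<in> extensional A" by (auto simp: hitting_colorings_def PiE_def)
    then show "?merge (restrict f X, restrict f (A - X)) = f"
      using XA by (auto simp: fun_eq_iff extensional_def)
  next
    fix p assume p: "p \<in> ?H \<times> ?T"
    obtain f g where fg: "p = (f, g)" by (cases p)
    have "f \<in> extensional X" "g \<in> extensional (A - X)"
      using p by (auto simp: fg hitting_colorings_def PiE_def)
    then show "(restrict (?merge p) X, restrict (?merge p) (A - X)) = p"
      by (auto simp: fg fun_eq_iff extensional_def restrict_def)
  qed
  then have "card (hitting_colorings A S a (insert X K)) = card ?H * card ?T"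
    by (simp add: bij_betw_same_card card_cartesian_product)
  also have "card ?H = hit_weight (card S) (card X)"
    by (rule card_hitting_functions[OF fX(1) assms(1,2)])
  also have "card ?T = (\<Prod>X\<in>K. hit_weight (card S) (card X)) * (card S - 1) ^ (card (A - X) - card (\<Union>K))"
    using insert.IH[OF _ dK KA] insert.prems by simp
  also have "card (A - X) - card (\<Union>K) = card A - card (\<Union>(insert X K))"
    using disj fX XA by (simp add: card_Un_disjoint card_Diff_subset)
  finally show ?case using insert.hyps by simp
qed

section \<open>Avoiders classified by their hit blocks\<close>

lemma eq_contains_123_iff_card_hit_blocks:
  assumes P: "partition_on A P" and "finite A"
  shows "eq_contains_123 a (P, f) \<longleftrightarrow> card (hit_blocks a P f) > 2"
proof
  have fin: "finite (hit_blocks a P f)"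
    using finite_elements[OF assms(2,1)] by (auto simp: hit_blocks_def)
  assume "eq_contains_123 a (P, f)"
  then obtain X Y Z where "X \<noteq> Y" "X \<noteq> Z" "Y \<noteq> Z" "{X, Y, Z} \<subseteq> hit_blocks a P f"
    unfolding eq_contains_123_def hit_blocks_def by auto
  then have "card {X, Y, Z} = 3" "card {X, Y, Z} \<le> card (hit_blocks a P f)"
    using fin by (simp, metis card_mono)
  then show "card (hit_blocks a P f) > 2" by simp
next
  assume "card (hit_blocks a P f) > 2"
  then obtain K where "K \<subseteq> hit_blocks a P f" "card K = 3"
    using obtain_subset_with_card_n[of 3 "hit_blocks a P f"] by auto
  then obtain X Y Z where XYZ: "X \<noteq> Y" "X \<noteq> Z" "Y \<noteq> Z" "{X, Y, Z} \<subseteq> hit_blocks a P f"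
    by (auto simp: card_3_iff)
  then obtain x y z where xyz: "x \<in> X" "y \<in> Y" "z \<in> Z" "f x = a" "f y = a" "f z = a"
    and P3: "X \<in> P" "Y \<in> P" "Z \<in> P"
    by (auto simp: hit_blocks_def)
  have "x \<noteq> y" "x \<noteq> z" "y \<noteq> z"
    using P XYZ P3 xyz by (auto simp: partition_on_def disjoint_def)
  \<comment> \<open>The pattern is symmetric in the three blocks and uses a single color, so each of
    the six orderings of the chosen elements gives an occurrence.\<close>
  then consider "x < y" "y < z" | "x < z" "z < y" | "y < x" "x < z" | "y < z" "z < x"
    | "z < x" "x < y" | "z < y" "y < x"
    by linarith
  then show "eq_contains_123 a (P, f)"
    unfolding eq_contains_123_def prod.case
    by cases (use XYZ(1-3) xyz P3 in blast)+
qed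

text \<open>Any element of color \<open>a\<close> is forced into some block of \<open>K\<close>, and
  by disjointness that is its only block in \<open>P\<close>. Given \<open>K \<subseteq> P\<close>,
  the condition on \<open>f\<close> thus becomes independent of \<open>P\<close>.\<close>

lemma hit_blocks_eq_iff:
  assumes "partition_on A P" "K \<subseteq> P"
  shows "hit_blocks a P f = K \<longleftrightarrow> (\<forall>X\<in>K. \<exists>x\<in>X. f x = a) \<and> (\<forall>x\<in>A - \<Union>K. f x \<noteq> a)"
proof
  assume "hit_blocks a P f = K"
  then show "(\<forall>X\<in>K. \<exists>x\<in>X. f x = a) \<and> (\<forall>x\<in>A - \<Union>K. f x \<noteq> a)"
    using assms(1) by (auto simp: hit_blocks_def partition_on_def)
next
  assume R: "(\<forall>X\<in>K. \<exists>x\<in>X. f x = a) \<and> (\<forall>x\<in>A - \<Union>K. f x \<noteq> a)"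
  have "X \<in> K" if X: "X \<in> P" "x \<in> X" "f x = a" for X x
  proof -
    have "x \<in> A" using X assms(1) by (auto simp: partition_on_def)
    then obtain Y where "Y \<in> K" "x \<in> Y" using R X by blast
    moreover have "Y \<in> P" using \<open>Y \<in> K\<close> assms(2) by blast
    ultimately have "X = Y"
      using X partition_on_block_unique[OF assms(1)] \<open>x \<in> Y\<close> by blast
    then show ?thesis using \<open>Y \<in> K\<close> by simp
  qed
  then show "hit_blocks a P f = K" using R assms(2) by (auto simp: hit_blocks_def)
qed

text \<open>The candidates for \<open>hit_blocks\<close> of an avoider.
  \<open>partition_on (\<Union>K) K\<close> encodes that the members of \<open>K\<close> are
  nonempty and pairwise disjoint. For finite \<open>A\<close> every such \<open>K\<close> is finite,
  so \<open>card K \<le> 2\<close> is a genuine bound.\<close>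

definition small_families :: "'a set \<Rightarrow> 'a set set set" where
  "small_families A = {K. partition_on (\<Union>K) K \<and> \<Union>K \<subseteq> A \<and> card K \<le> 2}"

lemma finite_small_families: "finite A \<Longrightarrow> finite (small_families A)"
  by (rule finite_subset[of _ "Pow (Pow A)"]) (auto simp: small_families_def)

text \<open>The avoiders are the disjoint union, over the possible families \<open>K\<close> of hit
  blocks, of products of a set of partitions with a set of colorings; both factors have been
  counted.\<close>

lemma card_eq_avoiders_123:
  assumes "a \<in> {1..c}"
  shows "card (eq_avoiders_123 n c a) = (\<Sum>K\<in>small_families {1..n}.
    Bell (n - card (\<Union>K)) * ((\<Prod>X\<in>K. hit_weight c (card X)) * (c - 1) ^ (n - card (\<Union>K))))"
proof -
  let ?A = "{1..n}"
  let ?F = "\<lambda>K. {P. partition_on ?A P \<and> K \<subseteq> P} \<times> hitting_colorings ?A {1..c} a K"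
  have "finite {P. partition_on ?A P \<and> K \<subseteq> P}" for K
    by (rule finite_subset[OF _ finitely_many_partition_on[of ?A]]) auto
  moreover have "finite (hitting_colorings ?A {1..c} a K)" for K
    by (rule finite_subset[of _ "?A \<rightarrow>\<^sub>E {1..c}"]) (auto simp: hitting_colorings_def intro: finite_PiE)
  ultimately have finF: "finite (?F K)" for K
    by (intro finite_cartesian_product)
  \<comment> \<open>\<open>K\<close> can be recovered from any member of \<open>?F K\<close>, which
    makes these sets disjoint for different \<open>K\<close>.\<close>
  have hit: "hit_blocks a P f = K" if "(P, f) \<in> ?F K" for P f K
    using that hit_blocks_eq_iff[of ?A P K a f] by (auto simp: hitting_colorings_def)
  have "eq_avoiders_123 n c a = (\<Union>K\<in>small_families ?A. ?F K)"
  proof (intro set_eqI iffI)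
    fix \<sigma> assume s: "\<sigma> \<in> eq_avoiders_123 n c a"
    obtain P f where Pf: "\<sigma> = (P, f)" by (cases \<sigma>)
    let ?K = "hit_blocks a P f"
    have P: "partition_on ?A P" and f: "f \<in> ?A \<rightarrow>\<^sub>E {1..c}" and "card ?K \<le> 2"
      using s eq_contains_123_iff_card_hit_blocks[of ?A P a f]
      by (auto simp: Pf eq_avoiders_123_def colored_partitions_def)
    moreover have KP: "?K \<subseteq> P" by (auto simp: hit_blocks_def)
    moreover have "partition_on (\<Union>?K) ?K" "\<Union>?K \<subseteq> ?A"
      using P KP pairwise_subset[of disjnt P ?K] by (auto simp: partition_on_def)
    moreover have "f \<in> hitting_colorings ?A {1..c} a ?K"
      using f hit_blocks_eq_iff[OF P KP, of a f] by (auto simp: hitting_colorings_def)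
    ultimately show "\<sigma> \<in> (\<Union>K\<in>small_families ?A. ?F K)"
      by (auto simp: Pf small_families_def)
  next
    fix \<sigma> assume "\<sigma> \<in> (\<Union>K\<in>small_families ?A. ?F K)"
    then obtain P f K where Pf: "\<sigma> = (P, f)" "(P, f) \<in> ?F K" "K \<in> small_families ?A" by auto
    then have "partition_on ?A P" "card (hit_blocks a P f) \<le> 2" "f \<in> ?A \<rightarrow>\<^sub>E {1..c}"
      using hit[OF Pf(2)] by (auto simp: small_families_def hitting_colorings_def)
    then show "\<sigma> \<in> eq_avoiders_123 n c a"
      using eq_contains_123_iff_card_hit_blocks[of ?A P a f]
      by (auto simp: Pf(1) eq_avoiders_123_def colored_partitions_def)
  qed
  also have "card \<dots> = (\<Sum>K\<in>small_families ?A. card (?F K))"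
  proof (rule card_UN_disjoint)
    have "K = L" if "\<sigma> \<in> ?F K" "\<sigma> \<in> ?F L" for K L \<sigma>
      using hit[of "fst \<sigma>" "snd \<sigma>"] that by (metis prod.collapse)
    then show "\<forall>K\<in>small_families ?A. \<forall>L\<in>small_families ?A. K \<noteq> L \<longrightarrow> ?F K \<inter> ?F L = {}"
      by (meson disjoint_iff)
  qed (use finite_small_families finF in auto)
  also have "\<dots> = (\<Sum>K\<in>small_families {1..n}.
    Bell (n - card (\<Union>K)) * ((\<Prod>X\<in>K. hit_weight c (card X)) * (c - 1) ^ (n - card (\<Union>K))))"
  proof (rule sum.cong)
    fix K assume K: "K \<in> small_families ?A"
    then have K': "partition_on (\<Union>K) K" "\<Union>K \<subseteq> ?A" "disjoint K"
      by (auto simp: small_families_def partition_on_def)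
    then have "finite K" by (meson finite_UnionD finite_atLeastAtMost finite_subset)
    then show "card (?F K) = Bell (n - card (\<Union>K)) *
        ((\<Prod>X\<in>K. hit_weight c (card X)) * (c - 1) ^ (n - card (\<Union>K)))"
      using card_partitions_containing[of ?A K] card_hitting_colorings[of "{1..c}" a K ?A] K' assms
      by (simp add: card_cartesian_product)
  qed simp
  finally show ?thesis .
qed

section \<open>Summation over subsets and over families of at most two blocks\<close>

lemma sum_nonempty_subsets_card:
  fixes g :: "nat \<Rightarrow> 'b::comm_semiring_1"
  assumes "finite A"
  shows "(\<Sum>X\<in>Pow A - {{}}. g (card X)) = (\<Sum>i=1..card A. of_nat (card A choose i) * g i)"
proof -
  have "(\<Sum>X\<in>Pow A - {{}}. g (card X)) =
      (\<Sum>i=1..card A. \<Sum>X\<in>{X \<in> Pow A - {{}}. card X = i}. g (card X))"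
  proof (rule sum.group[symmetric])
    show "card ` (Pow A - {{}}) \<subseteq> {1..card A}"
      using assms by (auto simp: card_mono Suc_le_eq card_gt_0_iff finite_subset)
  qed (use assms in auto)
  also have "\<dots> = (\<Sum>i=1..card A. of_nat (card A choose i) * g i)"
  proof (rule sum.cong)
    fix i assume "i \<in> {1..card A}"
    then have "{X \<in> Pow A - {{}}. card X = i} = {X. X \<subseteq> A \<and> card X = i}" by auto
    then show "(\<Sum>X\<in>{X \<in> Pow A - {{}}. card X = i}. g (card X)) = of_nat (card A choose i) * g i"
      using n_subsets[OF assms] by simp
  qed simp
  finally show ?thesis .
qed

text \<open>An unordered pair of blocks is coded uniquely by its union \<open>U\<close> and the
  block \<open>Y\<close> that misses \<open>Min U\<close>. So \<open>Y\<close> runs over the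
  nonempty subsets of \<open>U - {Min U}\<close>, and each pair is counted once.\<close>

lemma sum_small_families:
  fixes A :: "'a::linorder set" and g :: "'a set set \<Rightarrow> 'b::comm_monoid_add"
  assumes "finite A"
  shows "sum g (small_families A) = g {} + (\<Sum>X\<in>Pow A - {{}}. g {X}) +
    (\<Sum>U\<in>Pow A - {{}}. \<Sum>Y\<in>Pow (U - {Min U}) - {{}}. g {U - Y, Y})"
proof -
  let ?one = "(\<lambda>X. {X}) ` (Pow A - {{}})"
  let ?I = "SIGMA U:Pow A - {{}}. Pow (U - {Min U}) - {{}}"
  let ?pair = "\<lambda>(U, Y). {U - Y, Y}"
  have fU: "finite U" if "U \<subseteq> A" for U using that assms finite_subset by blast
  \<comment> \<open>\<open>U - Y\<close> contains \<open>Min U\<close> and \<open>Y\<close> does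
    not, so the two blocks differ; this separates pairs from singletons.\<close>
  have I: "U \<subseteq> A" "Y \<subseteq> U" "Y \<noteq> {}" "Min U \<in> U - Y" "U - Y \<noteq> Y" if "(U, Y) \<in> ?I" for U Y
    using that Min_in[of U] fU by auto
  have two: "\<exists>p\<in>?I. K = ?pair p" if K: "K \<in> small_families A" "card K = 2" for K
  proof -
    have pair: "\<exists>p\<in>?I. K = ?pair p"
      if "K = {X, Y}" "X \<inter> Y = {}" "X \<noteq> {}" "Y \<noteq> {}" "X \<union> Y \<subseteq> A" "Min (X \<union> Y) \<in> X" for X Y
      using that by (intro bexI[of _ "(X \<union> Y, Y)"]) auto
    obtain X Y where XY: "K = {X, Y}" "X \<noteq> Y" using K(2) by (auto simp: card_2_iff)
    then have *: "X \<inter> Y = {}" "X \<noteq> {}" "Y \<noteq> {}" "X \<union> Y \<subseteq> A"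
      using K(1) by (auto simp: small_families_def partition_on_def disjoint_def)
    \<comment> \<open>The minimum lies in one of the two blocks, which then plays the role of
      \<open>U - Y\<close>; hence \<open>pair\<close> is invoked in both orders.\<close>
    then have "Min (X \<union> Y) \<in> X \<union> Y" by (intro Min_in fU) auto
    then show ?thesis
      using pair[of X Y] pair[of Y X] * XY(1) by (auto simp: Un_commute Int_commute insert_commute)
  qed
  have "small_families A = {{}} \<union> ?one \<union> ?pair ` ?I"
  proof (intro set_eqI iffI)
    fix K assume K: "K \<in> small_families A"
    then have "finite K"
      by (auto simp: small_families_def intro: finite_UnionD fU)
    moreover have "card K \<le> 2" using K by (simp add: small_families_def)
    ultimately consider "K = {}" | X where "K = {X}" | "card K = 2"
      by (metis One_nat_def card_0_eq card_1_singletonE le_SucE le_zero_eq numeral_2_eq_2)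
    then show "K \<in> {{}} \<union> ?one \<union> ?pair ` ?I"
    proof cases
      case 2
      then show ?thesis using K by (auto simp: small_families_def partition_on_def)
    next
      case 3
      then show ?thesis using two[OF K] by blast
    qed simp
  next
    fix K assume "K \<in> {{}} \<union> ?one \<union> ?pair ` ?I"
    then consider "K = {}" | X where "K = {X}" "X \<subseteq> A" "X \<noteq> {}"
      | U Y where "K = {U - Y, Y}" "(U, Y) \<in> ?I" by auto
    then show "K \<in> small_families A"
    proof cases
      case 3
      then show ?thesis using I[OF 3(2)]
        by (auto simp: small_families_def partition_on_def disjoint_def)
    qed (auto simp: small_families_def partition_on_def disjoint_def)
  qed
  moreover have "?one \<inter> ?pair ` ?I = {}"
  proof -
    have "{X} \<noteq> {U - Y, Y}" if "(U, Y) \<in> ?I" for X U Y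
      using I(5)[OF that] by auto
    then show ?thesis by fast
  qed
  moreover have "{} \<notin> ?one \<union> ?pair ` ?I" by auto
  moreover have "finite ?one" "finite (?pair ` ?I)"
    using assms fU by (auto intro!: finite_imageI finite_SigmaI)
  ultimately have "sum g (small_families A) = g {} + sum g ?one + sum g (?pair ` ?I)"
    by (simp add: sum.union_disjoint add.assoc)
  also have "sum g ?one = (\<Sum>X\<in>Pow A - {{}}. g {X})"
    by (subst sum.reindex) (auto simp: inj_on_def)
  also have "sum g (?pair ` ?I) = (\<Sum>p\<in>?I. g (?pair p))"
  proof (subst sum.reindex)
    \<comment> \<open>The union of the pair returns \<open>U\<close>; a swap of the two blocks is
      impossible because only the first contains the minimum.\<close>
    have pair_inj: "U = V \<and> Y = Z" if *: "(U, Y) \<in> ?I" "(V, Z) \<in> ?I" "{U - Y, Y} = {V - Z, Z}" for U V Y Z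
    proof -
      have "U = \<Union>{U - Y, Y}" "V = \<Union>{V - Z, Z}" using I(2)[OF *(1)] I(2)[OF *(2)] by auto
      then have "U = V" using *(3) by simp
      moreover have "Y = Z"
        using *(3) I(4)[OF *(1)] I(4)[OF *(2)] \<open>U = V\<close> by (auto simp: doubleton_eq_iff)
      ultimately show ?thesis by simp
    qed
    show "inj_on ?pair ?I"
    proof (rule inj_onI)
      fix p q assume pq: "p \<in> ?I" "q \<in> ?I" "?pair p = ?pair q"
      then show "p = q" using pair_inj[of "fst p" "snd p" "fst q" "snd q"]
        by (simp add: case_prod_unfold prod_eq_iff)
    qed
  qed simp
  also have "\<dots> = (\<Sum>U\<in>Pow A - {{}}. \<Sum>Y\<in>Pow (U - {Min U}) - {{}}. g {U - Y, Y})"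
    using assms fU by (subst sum.Sigma) (auto simp: case_prod_unfold)
  finally show ?thesis .
qed

section \<open>Evaluation of the sum over families by block sizes\<close>

theorem theorem5p3:
  fixes n c a :: nat
  assumes "n \<ge> 1" and "c \<ge> 1" and "a \<in> {1..c}"
  shows "card (eq_avoiders_123 n c a) =
      Bell n * (c - 1) ^ n
    + (\<Sum>i=1..n. \<Sum>r=1..i.
         (n choose i) * (i choose r) * Bell (n - i) * (c - 1) ^ (n - r))
    + (\<Sum>i=2..n. \<Sum>j=1..i - 1. \<Sum>r1=1..i - j. \<Sum>r2=1..j.
         (n choose i) * ((i - 1) choose j) * ((i - j) choose r1) * (j choose r2)
           * Bell (n - i) * (c - 1) ^ (n - r1 - r2))"
proof -
  let ?A = "{1..n}"
  let ?w = "hit_weight c"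
  \<comment> \<open>Contribution of the \<open>n - i\<close> elements outside the hit blocks: they
    are partitioned freely and colored without \<open>a\<close>.\<close>
  let ?b = "\<lambda>i. Bell (n - i) * (c - 1) ^ (n - i)"
  define g where "g K = Bell (n - card (\<Union>K)) *
    ((\<Prod>X\<in>K. ?w (card X)) * (c - 1) ^ (n - card (\<Union>K)))" for K :: "nat set set"
  have "card (eq_avoiders_123 n c a) = sum g (small_families ?A)"
    using card_eq_avoiders_123[OF assms(3), of n] by (simp add: g_def)
  also have "\<dots> = g {} + (\<Sum>X\<in>Pow ?A - {{}}. g {X}) +
    (\<Sum>U\<in>Pow ?A - {{}}. \<Sum>Y\<in>Pow (U - {Min U}) - {{}}. g {U - Y, Y})"
    by (rule sum_small_families) simp
  also have "g {} = Bell n * (c - 1) ^ n" by (simp add: g_def)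
  also have "(\<Sum>X\<in>Pow ?A - {{}}. g {X}) = (\<Sum>X\<in>Pow ?A - {{}}. ?w (card X) * ?b (card X))"
    by (simp add: g_def ac_simps)
  also have "\<dots> = (\<Sum>i=1..n. (n choose i) * (?w i * ?b i))"
    by (subst sum_nonempty_subsets_card) simp_all
  also have "\<dots> = (\<Sum>i=1..n. \<Sum>r=1..i.
         (n choose i) * (i choose r) * Bell (n - i) * (c - 1) ^ (n - r))"
  proof (intro sum.cong refl)
    fix i assume i: "i \<in> {1..n}"
    have "(n choose i) * ((i choose r) * (c - 1) ^ (i - r) * ?b i) =
        (n choose i) * (i choose r) * Bell (n - i) * (c - 1) ^ (n - r)" if r: "r \<in> {1..i}" for r
    proof -
      \<comment> \<open>Elements not colored \<open>a\<close>: those inside the hit block and those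
        outside it.\<close>
      have "n - r = (i - r) + (n - i)" using r i by auto
      then show ?thesis by (simp add: power_add)
    qed
    then show "(n choose i) * (?w i * ?b i) =
        (\<Sum>r=1..i. (n choose i) * (i choose r) * Bell (n - i) * (c - 1) ^ (n - r))"
      unfolding hit_weight_def sum_distrib_left sum_distrib_right by (rule sum.cong[OF refl])
  qed
  also have "(\<Sum>U\<in>Pow ?A - {{}}. \<Sum>Y\<in>Pow (U - {Min U}) - {{}}. g {U - Y, Y}) =
    (\<Sum>U\<in>Pow ?A - {{}}. \<Sum>j=1..card U - 1. (card U - 1 choose j) * (?w (card U - j) * ?w j * ?b (card U)))"
  proof (rule sum.cong)
    fix U assume U: "U \<in> Pow ?A - {{}}"
    then have fU: "finite U" by (auto intro: finite_subset)
    then have min: "Min U \<in> U" using U by (intro Min_in) auto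
    have "(\<Sum>Y\<in>Pow (U - {Min U}) - {{}}. g {U - Y, Y}) =
        (\<Sum>Y\<in>Pow (U - {Min U}) - {{}}. ?w (card U - card Y) * ?w (card Y) * ?b (card U))"
    proof (rule sum.cong)
      fix Y assume "Y \<in> Pow (U - {Min U}) - {{}}"
      then have Y: "Y \<subseteq> U" "Y \<noteq> {}" "finite Y" using fU by (auto intro: finite_subset)
      then have "U - Y \<noteq> Y" "\<Union>{U - Y, Y} = U" "card (U - Y) = card U - card Y"
        by (auto simp: card_Diff_subset)
      then show "g {U - Y, Y} = ?w (card U - card Y) * ?w (card Y) * ?b (card U)"
        unfolding g_def by (simp add: ac_simps)
    qed simp
    also have "\<dots> = (\<Sum>j=1..card U - 1. (card U - 1 choose j) * (?w (card U - j) * ?w j * ?b (card U)))"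
      \<comment> \<open>Choosing \<open>Y\<close> without \<open>Min U\<close> leaves
        \<open>card U - 1\<close> elements, the source of the binomial coefficient with top
        \<open>i - 1\<close>.\<close>
      using fU min sum_nonempty_subsets_card[of "U - {Min U}" "\<lambda>j. ?w (card U - j) * ?w j * ?b (card U)"]
      by simp
    finally show "(\<Sum>Y\<in>Pow (U - {Min U}) - {{}}. g {U - Y, Y}) = \<dots>" .
  qed simp
  also have "\<dots> = (\<Sum>i=1..n. (n choose i) *
      (\<Sum>j=1..i - 1. (i - 1 choose j) * (?w (i - j) * ?w j * ?b i)))"
    by (subst sum_nonempty_subsets_card) simp_all
  \<comment> \<open>The term for i = 1 vanishes, since its inner sum runs over the empty range
    \<open>{1..0}\<close>.\<close>
  also have "\<dots> = (\<Sum>i=2..n. (n choose i) *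
      (\<Sum>j=1..i - 1. (i - 1 choose j) * (?w (i - j) * ?w j * ?b i)))"
    using assms(1) by (subst sum.atLeast_Suc_atMost) (auto simp: numeral_2_eq_2)
  also have "\<dots> = (\<Sum>i=2..n. \<Sum>j=1..i - 1. \<Sum>r1=1..i - j. \<Sum>r2=1..j.
         (n choose i) * ((i - 1) choose j) * ((i - j) choose r1) * (j choose r2)
           * Bell (n - i) * (c - 1) ^ (n - r1 - r2))"
    unfolding sum_distrib_left
  proof (intro sum.cong refl)
    fix i j assume i: "i \<in> {2..n}" and j: "j \<in> {1..i - 1}"
    have "(n choose i) * ((i - 1 choose j) * ((i - j choose r1) * (c - 1) ^ (i - j - r1) *
          ((j choose r2) * (c - 1) ^ (j - r2)) * ?b i)) =
        (n choose i) * ((i - 1) choose j) * ((i - j) choose r1) * (j choose r2) *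
          Bell (n - i) * (c - 1) ^ (n - r1 - r2)"
      if r: "r1 \<in> {1..i - j}" "r2 \<in> {1..j}" for r1 r2
    proof -
      \<comment> \<open>Elements not colored \<open>a\<close>, in the block with the minimum, in the
        other hit block, and outside both.\<close>
      have "n - r1 - r2 = (i - j - r1) + (j - r2) + (n - i)" using r i j by auto
      then show ?thesis by (simp add: power_add)
    qed
    then show "(n choose i) * ((i - 1 choose j) * (?w (i - j) * ?w j * ?b i)) =
        (\<Sum>r1=1..i - j. \<Sum>r2=1..j. (n choose i) * ((i - 1) choose j) * ((i - j) choose r1) *
          (j choose r2) * Bell (n - i) * (c - 1) ^ (n - r1 - r2))"
      unfolding hit_weight_def sum_product unfolding sum_distrib_left sum_distrib_right
      by (intro sum.cong refl)
  qed
  finally show ?thesis .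
qed

end
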